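(* Let $\tau\ge1$, $\sigma=(\sigma_1,\dots,\sigma_\tau)\in\mathbb{Z}_{\ge1}^\tau$, and define $S:=\prod_{i=1}^\tau(\sigma_i+1)$. (i) Let $\mathcal{A}$ be an integer matrix such that $\mathcal{A}^\intercal\in\mathbb{Z}^{S\times(S-1)}$ is bi-diagonal. Then, up to a permutation of its rows, $\mathcal{A}$ is a tree-fold matrix with $\tau$ levels and level sizes $\sigma$. (ii) Let $\mathcal{A}$ be an integer matrix such that $\mathcal{A}^\intercal\in\mathbb{Z}^{2S\times(2S-2)}$ is tri-diagonal. Then, up to a permutation of its rows, $\mathcal{A}$ is a tree-fold matrix with $\tau$ levels and level sizes $2\sigma=(2\sigma_1,\dots,2\sigma_\tau)$.
   Context: A matrix $M=(m_{i,j})$ with integer entries is bi-diagonal if $m_{i,j}=0$ whenever $i\notin\{j,j+1\}$, and tri-diagonal if $m_{i,j}=0$ whenever $i\notin\{j,j+1,j+2\}$. Tree-fold matrices (recursive definition): any matrix $A\in\mathbb{Z}^{m\times n}$ is a tree-fold matrix with one level and level size $m$. A matrix $A$ is a tree-fold matrix with $\tau\ge 2$ levels and level sizes $\sigma=(\sigma_1,\dots,\sigma_\tau)\in\mathbb{Z}_{\ge1}^\tau$ if deleting the first $\sigma_1$ rows of $A$ decomposes the matrix into a block-diagonal matrix, where each (not necessarily square) block is a tree-fold matrix with $\tau-1$ levels and level sizes $(\sigma_2,\dots,\sigma_\tau)$. *)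

theory Defs
  imports
    "Jordan_Normal_Form.Matrix"
    "HOL-Combinatorics.Permutations"
begin

text \<open>Indices of \<^typ>\<open>int mat\<close> start at 0; the conditions below are invariant under
  shifting both indices by one.\<close>

definition bidiagonal :: "int mat \<Rightarrow> bool" where
  "bidiagonal M \<longleftrightarrow>
     (\<forall>i < dim_row M. \<forall>j < dim_col M. i \<notin> {j, j + 1} \<longrightarrow> M $$ (i, j) = 0)"

definition tridiagonal :: "int mat \<Rightarrow> bool" where
  "tridiagonal M \<longleftrightarrow>
     (\<forall>i < dim_row M. \<forall>j < dim_col M. i \<notin> {j, j + 1, j + 2} \<longrightarrow> M $$ (i, j) = 0)"

definition delete_first_rows :: "nat \<Rightarrow> int mat \<Rightarrow> int mat" where
  "delete_first_rows k A = mat (dim_row A - k) (dim_col A) (\<lambda>(i, j). A $$ (i + k, j))"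

text \<open>The number of levels is the length of the list of level sizes. Matrix dimensions are
  positive: without \<open>1 \<le> n\<close> and \<open>Bs \<noteq> []\<close> blocks with no columns and empty block
  decompositions would be admitted.\<close>

inductive tree_fold :: "nat list \<Rightarrow> int mat \<Rightarrow> bool" where
  one_level: "tree_fold [m] A"
    if "1 \<le> m" and "1 \<le> n" and "A \<in> carrier_mat m n"
| more_levels: "tree_fold (s # \<sigma>) A"
    if "1 \<le> s" and "\<sigma> \<noteq> []" and "s \<le> dim_row A" and "Bs \<noteq> []"
      and "delete_first_rows s A = diag_block_mat Bs"
      and "\<forall>B \<in> set Bs. tree_fold \<sigma> B"

definition permute_rows :: "(nat \<Rightarrow> nat) \<Rightarrow> int mat \<Rightarrow> int mat" where
  "permute_rows p A = mat (dim_row A) (dim_col A) (\<lambda>(i, j). A $$ (p i, j))"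

definition tree_fold_up_to_row_perm :: "nat list \<Rightarrow> int mat \<Rightarrow> bool" where
  "tree_fold_up_to_row_perm \<sigma> A \<longleftrightarrow>
     (\<exists>p. p permutes {..<dim_row A} \<and> tree_fold \<sigma> (permute_rows p A))"

end

(* Both parts are the cases c = 1 and c = 2 of one claim on matrices with c * (S - 1) rows and
   c * S columns whose row r is supported in the columns r, ..., r + c. Write w = c * S' for the
   product S' belonging to the levels below the first. Moving the last c rows of each of the first
   s stretches of w consecutive rows to the top leaves s + 1 stretches of w - c rows, and the k-th of
   them is supported in the columns k * w, ..., (k + 1) * w - 1. So the rest is block-diagonal with
   blocks of the same kind, and one concludes by induction on the number of levels. *)

theory Submission
  imports Defs
begin

text \<open>The matrix is a total function \<open>f\<close> on all index pairs, read through a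
  column window starting at \<open>a\<close>. Every block at every level is thus a window of the
  same \<open>f\<close> in absolute coordinates, and a list of rows replaces the permutation, so no
  permutations have to be composed across levels.\<close>

definition row_selection :: "(nat \<Rightarrow> nat \<Rightarrow> int) \<Rightarrow> nat list \<Rightarrow> nat \<Rightarrow> nat \<Rightarrow> int mat" where
  "row_selection f rs a n = mat (length rs) n (\<lambda>(i, j). f (rs ! i) (a + j))"

lemma dim_row_selection [simp]:
  "dim_row (row_selection f rs a n) = length rs"
  "dim_col (row_selection f rs a n) = n"
  by (simp_all add: row_selection_def)

lemma delete_first_rows_row_selection:
  "delete_first_rows (length xs) (row_selection f (xs @ ys) a n) = row_selection f ys a n"
  by (rule eq_matI) (auto simp: delete_first_rows_def row_selection_def nth_append)

lemma row_selection_append: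
  assumes "\<And>r j. r \<in> set xs \<Longrightarrow> a + m \<le> j \<Longrightarrow> f r j = 0"
    and "\<And>r j. r \<in> set ys \<Longrightarrow> j < a + m \<Longrightarrow> f r j = 0"
  shows "row_selection f (xs @ ys) a (m + n) =
    four_block_mat (row_selection f xs a m) (0\<^sub>m (length xs) n)
      (0\<^sub>m (length ys) m) (row_selection f ys (a + m) n)"
  by (rule eq_matI) (auto simp: row_selection_def nth_append assms)

text \<open>Each group of rows vanishes outside its own window of \<open>w\<close> columns, so only
  diagonal blocks survive. The groups may differ in length. Induction splits off the first group and
  moves the offset from \<open>a\<close> to \<open>a + w\<close>.\<close>

lemma row_selection_concat:
  assumes "\<And>k r j. k < length Ps \<Longrightarrow> r \<in> set (Ps ! k) \<Longrightarrow> f r j \<noteq> 0 \<Longrightarrow>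
      a + k * w \<le> j \<and> j < a + Suc k * w"
  shows "row_selection f (concat Ps) a (length Ps * w) =
    diag_block_mat (map (\<lambda>k. row_selection f (Ps ! k) (a + k * w) w) [0..<length Ps])"
  using assms
proof (induction Ps arbitrary: a)
  case Nil
  show ?case by (rule eq_matI) auto
next
  case (Cons P Ps)
  have tail: "a + w + k * w \<le> j \<and> j < a + w + Suc k * w"
    if "k < length Ps" "r \<in> set (Ps ! k)" "f r j \<noteq> 0" for k r j
    using Cons.prems[of "Suc k" r j] that by (simp add: add.assoc)
  have IH: "diag_block_mat (map (\<lambda>k. row_selection f (Ps ! k) (a + w + k * w) w) [0..<length Ps]) =
      row_selection f (concat Ps) (a + w) (length Ps * w)"
    using Cons.IH[OF tail] by simp
  have "row_selection f (P @ concat Ps) a (w + length Ps * w) =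
    four_block_mat (row_selection f P a w) (0\<^sub>m (length P) (length Ps * w))
      (0\<^sub>m (length (concat Ps)) w) (row_selection f (concat Ps) (a + w) (length Ps * w))"
  proof (rule row_selection_append)
    show "f r j = 0" if "r \<in> set P" "a + w \<le> j" for r j
      using Cons.prems[of 0 r j] that by fastforce
    show "f r j = 0" if r: "r \<in> set (concat Ps)" and "j < a + w" for r j
    proof -
      from r obtain P' where "P' \<in> set Ps" "r \<in> set P'"
        by auto
      then obtain k where "k < length Ps" "r \<in> set (Ps ! k)"
        by (metis in_set_conv_nth)
      from tail[OF this] \<open>j < a + w\<close> show ?thesis by fastforce
    qed
  qed
  moreover have "map (\<lambda>k. row_selection f ((P # Ps) ! k) (a + k * w) w) [0..<length (P # Ps)] =
      row_selection f P a w # map (\<lambda>k. row_selection f (Ps ! k) (a + w + k * w) w) [0..<length Ps]"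
    by (simp add: map_upt_Suc add.assoc del: upt_Suc)
  ultimately show ?case
    by (simp add: Let_def IH del: upt_Suc)
qed

text \<open>Heads of length \<open>u\<close> and tails of length \<open>w - u\<close> alternate and
  tile the interval, starting and ending with a head, hence one more head than tails. This certifies
  that moving the tails to the front only rearranges the rows.\<close>

lemma mset_upt_stretches:
  assumes "u \<le> w"
  shows "mset (concat (map (\<lambda>k. [a + k * w + u..<a + Suc k * w]) [0..<s])) +
    mset (concat (map (\<lambda>k. [a + k * w..<a + k * w + u]) [0..<Suc s])) = mset [a..<a + s * w + u]"
proof (induction s)
  case 0
  show ?case by simp
next
  case (Suc s)
  \<comment> \<open>The new rows are the tail of stretch \<open>s\<close> followed by the head of
    stretch \<open>Suc s\<close>.\<close>
  have "[a..<a + Suc s * w + u] = [a..<a + s * w + u] @ [a + s * w + u..<a + Suc s * w] @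
      [a + Suc s * w..<a + Suc s * w + u]"
    using upt_add_eq_append[of a "a + s * w + u" "w - u"]
      upt_add_eq_append[of a "a + Suc s * w" u] assms
    by (simp add: add.commute add.left_commute del: upt_Suc)
  then have "mset [a..<a + Suc s * w + u] = mset [a..<a + s * w + u] +
      mset [a + s * w + u..<a + Suc s * w] + mset [a + Suc s * w..<a + Suc s * w + u]"
    by (metis mset_append append_assoc)
  then show ?case
    unfolding Suc.IH[symmetric] by (simp add: add_ac)
qed

text \<open>The band is invariant under shifting both indices equally, so with \<open>a\<close>
  arbitrary the induction hypothesis applies directly to the block at \<open>a + k * w\<close>. The
  multiset equation says that \<open>rs\<close> rearranges the rows.\<close>

lemma banded_imp_tree_fold:
  assumes "c > 0" and band: "\<And>r j. f r j \<noteq> 0 \<Longrightarrow> r \<le> j \<and> j \<le> r + c"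
    and "\<sigma> \<noteq> []" and "\<forall>s \<in> set \<sigma>. 1 \<le> s"
  shows "\<exists>rs. mset rs = mset [a..<a + c * (prod_list (map Suc \<sigma>) - 1)] \<and>
    tree_fold (map ((*) c) \<sigma>) (row_selection f rs a (c * prod_list (map Suc \<sigma>)))"
  using assms(3,4)
proof (induction \<sigma> arbitrary: a rule: list_nonempty_induct)
  \<comment> \<open>One level only prescribes the number of rows, here
    \<open>c * (Suc s - 1) = c * s\<close>, so the rows stay in order.\<close>
  case (single s)
  have "tree_fold [c * s] (row_selection f [a..<a + c * s] a (c * Suc s))"
    using single \<open>c > 0\<close>
    by (intro tree_fold.one_level[where n = "c * Suc s"]) auto
  then show ?case by (intro exI[of _ "[a..<a + c * s]"]) simp
next
  case (cons s \<sigma>)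
  define T where "T = prod_list (map Suc \<sigma>)"
  define w where "w = c * T"
  \<comment> \<open>A block one level down has \<open>w\<close> columns but only \<open>u\<close>
    rows, so each stretch of \<open>w\<close> rows has \<open>c\<close> too many.\<close>
  define u where "u = c * (T - 1)"
  have "T > 0"
    unfolding T_def by (induction \<sigma>) auto
  then have w: "w = u + c"
    unfolding w_def u_def by (cases T) auto
  have "\<forall>k. \<exists>rs. mset rs = mset [a + k * w..<a + k * w + u] \<and>
      tree_fold (map ((*) c) \<sigma>) (row_selection f rs (a + k * w) w)"
    using cons.IH cons.prems unfolding T_def w_def u_def by auto
  then obtain P where P: "\<And>k. mset (P k) = mset [a + k * w..<a + k * w + u]"
    and tf: "\<And>k. tree_fold (map ((*) c) \<sigma>) (row_selection f (P k) (a + k * w) w)"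
    by metis
  define Ps where "Ps = map P [0..<Suc s]"
  \<comment> \<open>These are the rows \<open>r\<close> whose band, ending in column
    \<open>r + c\<close>, reaches the next window at \<open>a + Suc k * w\<close>.\<close>
  define top where "top = concat (map (\<lambda>k. [a + k * w + u..<a + Suc k * w]) [0..<s])"
  have len_top: "length top = c * s"
    unfolding top_def length_concat by (simp add: w comp_def sum_list_triv)
  have "mset (concat Ps) = mset (concat (map (\<lambda>k. [a + k * w..<a + k * w + u]) [0..<Suc s]))"
    unfolding Ps_def mset_concat map_map comp_def P ..
  then have "mset (top @ concat Ps) = mset [a..<a + s * w + u]"
    using mset_upt_stretches[of u w a s] w unfolding top_def by simp
  moreover have "s * w + u = c * (Suc s * T - 1)"
    using \<open>T > 0\<close> unfolding w_def u_def by (cases T) (auto simp: algebra_simps)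
  ultimately have mset: "mset (top @ concat Ps) = mset [a..<a + c * (Suc s * T - 1)]"
    by (simp add: add.assoc)
  have "row_selection f (concat Ps) a (length Ps * w) =
      diag_block_mat (map (\<lambda>k. row_selection f (Ps ! k) (a + k * w) w) [0..<length Ps])"
  proof (rule row_selection_concat)
    fix k r j
    assume k: "k < length Ps" and r: "r \<in> set (Ps ! k)" and "f r j \<noteq> 0"
    have "r \<in> set (P k)"
      using k r unfolding Ps_def by (simp del: upt_Suc)
    then have "r \<in> {a + k * w..<a + k * w + u}"
      using mset_eq_setD[OF P] by simp
    \<comment> \<open>The right end is strict: \<open>r < a + k * w + u\<close> gives
      \<open>j\<close> \<le> \<open>r + c\<close> < \<open>a + k * w + u + c\<close>, and
      \<open>u + c = w\<close>.\<close>
    then show "a + k * w \<le> j \<and> j < a + Suc k * w"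
      using band[OF \<open>f r j \<noteq> 0\<close>] w by auto
  qed
  also have "map (\<lambda>k. row_selection f (Ps ! k) (a + k * w) w) [0..<length Ps] =
      map (\<lambda>k. row_selection f (P k) (a + k * w) w) [0..<Suc s]"
    unfolding Ps_def by (auto simp del: upt_Suc)
  finally have blocks: "delete_first_rows (c * s) (row_selection f (top @ concat Ps) a (Suc s * w)) =
      diag_block_mat (map (\<lambda>k. row_selection f (P k) (a + k * w) w) [0..<Suc s])"
    using delete_first_rows_row_selection[of top] len_top unfolding Ps_def by simp
  have "tree_fold (c * s # map ((*) c) \<sigma>) (row_selection f (top @ concat Ps) a (Suc s * w))"
    using cons.prems cons.hyps \<open>c > 0\<close> tf
    by (intro tree_fold.more_levels[OF _ _ _ _ blocks]) (auto simp: len_top simp del: upt_Suc)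
  moreover have "Suc s * w = c * (Suc s * T)"
    unfolding w_def by (simp add: algebra_simps)
  ultimately show ?case
    using mset unfolding T_def by (intro exI[of _ "top @ concat Ps"]) (simp del: mult_Suc)
qed

lemma banded_mat_tree_fold_up_to_row_perm:
  assumes "c > 0" and "\<sigma> \<noteq> []" and "\<forall>s \<in> set \<sigma>. 1 \<le> s"
    and A: "A \<in> carrier_mat (c * (prod_list (map Suc \<sigma>) - 1)) (c * prod_list (map Suc \<sigma>))"
    and band: "\<And>i j. i < dim_row A \<Longrightarrow> j < dim_col A \<Longrightarrow> A $$ (i, j) \<noteq> 0 \<Longrightarrow> i \<le> j \<and> j \<le> i + c"
  shows "tree_fold_up_to_row_perm (map ((*) c) \<sigma>) A"
proof -
  \<comment> \<open>Extension by 0 makes the band condition hold at all index pairs, not only inside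
    \<open>A\<close>.\<close>
  define f where "f = (\<lambda>i j. if i < dim_row A \<and> j < dim_col A then A $$ (i, j) else 0)"
  have "\<And>r j. f r j \<noteq> 0 \<Longrightarrow> r \<le> j \<and> j \<le> r + c"
    using band unfolding f_def by (metis (full_types))
  from banded_imp_tree_fold[where a = 0, OF \<open>c > 0\<close> this assms(2,3)]
  obtain rs where rs: "mset rs = mset [0..<dim_row A]"
    and tf: "tree_fold (map ((*) c) \<sigma>) (row_selection f rs 0 (dim_col A))"
    using A by auto
  \<comment> \<open>Permuting the list of indices themselves gives \<open>p i\<close> at position
    \<open>i\<close>, which is the row that \<open>permute_rows p\<close> puts there.\<close>
  from mset_eq_permutation[OF rs] obtain p
    where p: "p permutes {..<dim_row A}" and prs: "permute_list p [0..<dim_row A] = rs"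
    by auto
  have "length rs = dim_row A"
    using mset_eq_length[OF rs] by simp
  moreover have "rs ! i = p i" and "p i < dim_row A" if "i < dim_row A" for i
    using that p permutes_in_image[OF p, of i] prs[symmetric]
    by (auto simp: permute_list_nth)
  ultimately have "permute_rows p A = row_selection f rs 0 (dim_col A)"
    by (intro eq_matI) (auto simp: permute_rows_def row_selection_def f_def)
  then show ?thesis
    using p tf unfolding tree_fold_up_to_row_perm_def by metis
qed

theorem corollary1:
  fixes \<tau> :: nat and \<sigma> :: "nat list" and S :: nat
  assumes "1 \<le> \<tau>" and "length \<sigma> = \<tau>" and "\<forall>i < \<tau>. 1 \<le> \<sigma> ! i"
    and "S = (\<Prod>i < \<tau>. (\<sigma> ! i + 1))"
  shows "(\<forall>A :: int mat.
           transpose_mat A \<in> carrier_mat S (S - 1) \<and> bidiagonal (transpose_mat A)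
             \<longrightarrow> tree_fold_up_to_row_perm \<sigma> A) \<and>
         (\<forall>A :: int mat.
           transpose_mat A \<in> carrier_mat (2 * S) (2 * S - 2) \<and> tridiagonal (transpose_mat A)
             \<longrightarrow> tree_fold_up_to_row_perm (map (\<lambda>s. 2 * s) \<sigma>) A)"
proof -
  have S: "S = prod_list (map Suc \<sigma>)"
    using assms(2,4) by (simp add: prod.list_conv_set_nth atLeast0LessThan)
  have \<sigma>: "\<sigma> \<noteq> []" "\<forall>s \<in> set \<sigma>. 1 \<le> s"
    using assms(1,2,3) by (auto simp: in_set_conv_nth)
  have "tree_fold_up_to_row_perm \<sigma> A"
    if "transpose_mat A \<in> carrier_mat S (S - 1)" "bidiagonal (transpose_mat A)" for A
  proof -
    have "tree_fold_up_to_row_perm (map ((*) 1) \<sigma>) A"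
    proof (rule banded_mat_tree_fold_up_to_row_perm[OF _ \<sigma>])
      show "A \<in> carrier_mat (1 * (prod_list (map Suc \<sigma>) - 1)) (1 * prod_list (map Suc \<sigma>))"
        using that(1) S by auto
      \<comment> \<open>The entry of \<open>A\<close> at \<open>(i, j)\<close> is the entry of the
        transpose at \<open>(j, i)\<close>, so it can be nonzero only for \<open>j\<close> equal to
        \<open>i\<close> or \<open>i + 1\<close>.\<close>
      show "i \<le> j \<and> j \<le> i + 1" if "i < dim_row A" "j < dim_col A" "A $$ (i, j) \<noteq> 0" for i j
        using \<open>bidiagonal (transpose_mat A)\<close> that unfolding bidiagonal_def by fastforce
    qed simp
    moreover have "map ((*) 1) \<sigma> = \<sigma>"
      by (simp add: map_idI)
    ultimately show ?thesis by simp
  qed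
  moreover have "tree_fold_up_to_row_perm (map (\<lambda>s. 2 * s) \<sigma>) A"
    if "transpose_mat A \<in> carrier_mat (2 * S) (2 * S - 2)" "tridiagonal (transpose_mat A)" for A
  proof (rule banded_mat_tree_fold_up_to_row_perm[OF _ \<sigma>])
    show "A \<in> carrier_mat (2 * (prod_list (map Suc \<sigma>) - 1)) (2 * prod_list (map Suc \<sigma>))"
      using that(1) S by (auto simp: diff_mult_distrib2)
    show "i \<le> j \<and> j \<le> i + 2" if "i < dim_row A" "j < dim_col A" "A $$ (i, j) \<noteq> 0" for i j
      using \<open>tridiagonal (transpose_mat A)\<close> that unfolding tridiagonal_def by fastforce
  qed simp
  ultimately show ?thesis by blast
qed

end
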